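(* Let $R$ be a Noetherian commutative ring with identity, let $n\geq 2$ be an integer, and let ${\bf e}_1,\dots,{\bf e}_{n-1}$ be the standard basis (written as row vectors) of the free $R$-module $R^{n-1}$. Let $p_1,\dots,p_{n-1}\in R$ and consider the $n\times(n-1)$ matrix $$A=\left(\begin{array}{c} c_1{\bf e}_{i_1}\\ \vdots\\ c_n{\bf e}_{i_n}\end{array}\right),$$ where $c_k\in R$ for $k=1,\dots,n$ and $i_1,\dots,i_n\in\{1,\dots,n-1\}$. Let $$p_0=\sum_{k=1}^{n}(-1)^k\alpha_{k0}\Delta_k,$$ where $\alpha_{k0}\in R$ for all $k=1,\dots,n$ and $\Delta_k$ is the determinant of the $(n-1)\times(n-1)$ matrix obtained by dropping the $k$-th row of $A$. For all $k=1,\dots,n$ set $$q_k=\alpha_{k0}p_0+c_kp_{i_k}.$$ Then $$\sqrt{(p_0,\ c_1p_{i_1},\ \dots,\ c_np_{i_n})}=\sqrt{(q_1,\dots,q_n)}.$$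
   Context: For elements $a_1,\dots,a_s$ of $R$, $(a_1,\dots,a_s)$ denotes the ideal they generate, and $\sqrt{\,\cdot\,}$ denotes the radical of an ideal. *)

theory Defs
  imports "HOL-Algebra.Algebra" "HOL-Combinatorics.Permutations"
begin

text \<open>
  An \<open>m\<close> by \<open>m'\<close> matrix over \<open>R\<close> is a function \<open>M :: nat \<Rightarrow> nat \<Rightarrow> 'a\<close> of which only the entries
  \<open>M r s\<close> with \<open>r \<in> {1..m}\<close> and \<open>s \<in> {1..m'}\<close> matter.
\<close>

definition rdet :: "('a, 'b) ring_scheme \<Rightarrow> nat \<Rightarrow> (nat \<Rightarrow> nat \<Rightarrow> 'a) \<Rightarrow> 'a"
  where "rdet R m M =
    (\<Oplus>\<^bsub>R\<^esub>\<sigma> \<in> {\<sigma>. \<sigma> permutes {1..m}}. [sign \<sigma>] \<cdot>\<^bsub>R\<^esub> (\<Otimes>\<^bsub>R\<^esub>r \<in> {1..m}. M r (\<sigma> r)))"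

definition drop_row :: "nat \<Rightarrow> (nat \<Rightarrow> nat \<Rightarrow> 'a) \<Rightarrow> nat \<Rightarrow> nat \<Rightarrow> 'a"
  where "drop_row k M = (\<lambda>r s. M (if r < k then r else r + 1) s)"

definition basis_row :: "('a, 'b) ring_scheme \<Rightarrow> nat \<Rightarrow> nat \<Rightarrow> 'a"
  where "basis_row R i = (\<lambda>j. if j = i then \<one>\<^bsub>R\<^esub> else \<zero>\<^bsub>R\<^esub>)"

definition radical :: "('a, 'b) ring_scheme \<Rightarrow> 'a set \<Rightarrow> 'a set"
  where "radical R I = {x \<in> carrier R. \<exists>m::nat. m > 0 \<and> x [^]\<^bsub>R\<^esub> m \<in> I}"

end

theory Submission
  imports Defs
begin

text \<open>
  The maximal minors \<open>\<Delta>\<^sub>k\<close> of an \<open>n \<times> (n - 1)\<close> matrix satisfy \<open>\<Sum>\<^sub>k (-1)\<^sup>k \<Delta>\<^sub>k A\<^sub>k\<^sub>j = 0\<close> for every column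
  \<open>j\<close>: up to sign this is the Laplace expansion, along its last column, of the determinant of \<open>A\<close>
  with the \<open>j\<close>-th column repeated at the end. As \<open>c\<^sub>k p\<^bsub>i\<^sub>k\<^esub> = \<Sum>\<^sub>j A\<^sub>k\<^sub>j p\<^sub>j\<close>, it follows that
  \<open>\<Sum>\<^sub>k (-1)\<^sup>k \<Delta>\<^sub>k q\<^sub>k = p\<^sub>0\<^sup>2\<close>. So \<open>p\<^sub>0\<close>, and with it each \<open>c\<^sub>k p\<^bsub>i\<^sub>k\<^esub> = q\<^sub>k - \<alpha>\<^sub>k p\<^sub>0\<close>, lies in the radical of
  the ideal generated by the \<open>q\<^sub>k\<close>; the other inclusion is immediate.
\<close>

subsection \<open>Laplace expansion along the last column\<close>

text \<open>The cycle k -> k+1 -> ... -> n -> k. For \<open>k \<le> n\<close> it agrees below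
  \<open>n\<close> with the renumbering of rows in \<open>drop_row k\<close> and sends the last
  index \<open>n\<close> to the dropped row \<open>k\<close>, so reindexing a product by it
  separates row \<open>k\<close> from the rows of the minor.\<close>

definition row_cycle :: "nat \<Rightarrow> nat \<Rightarrow> nat \<Rightarrow> nat"
  where "row_cycle k n r = (if r < k \<or> n < r then r else if r = n then k else r + 1)"

lemma row_cycle_refl: "row_cycle n n = id"
  by (auto simp: row_cycle_def)

text \<open>Splits one adjacent transposition off the cycle. Both downward inductions on
  \<open>k\<close> below, for being a permutation and for the sign, rest on it.\<close>

lemma row_cycle_step:
  "k < n \<Longrightarrow> row_cycle k n = Transposition.transpose k (Suc k) \<circ> row_cycle (Suc k) n"
  by (auto simp: row_cycle_def Transposition.transpose_def fun_eq_iff)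

lemma row_cycle_permutes: "k \<le> n \<Longrightarrow> row_cycle k n permutes {k..n}"
proof (induction k rule: inc_induct)
  case base
  then show ?case unfolding row_cycle_refl by (rule permutes_id)
next
  case (step k)
  have "row_cycle (Suc k) n permutes {k..n}"
    using step.IH by (rule permutes_subset) auto
  moreover have "Transposition.transpose k (Suc k) permutes {k..n}"
    using step.hyps by (intro permutes_swap_id) auto
  ultimately show ?case
    unfolding row_cycle_step[OF step.hyps(2)] by (rule permutes_compose)
qed

text \<open>The cycle is a product of \<open>n - k\<close> adjacent transpositions, each
  contributing a factor -1.\<close>

lemma sign_row_cycle: "k \<le> n \<Longrightarrow> sign (row_cycle k n) = (- 1) ^ (n - k)"
proof (induction k rule: inc_induct)
  case base
  then show ?case by (simp add: row_cycle_refl)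
next
  case (step k)
  have "permutation (row_cycle (Suc k) n)"
    using step.hyps row_cycle_permutes[of "Suc k" n] by (auto intro: permutes_imp_permutation)
  then have "sign (row_cycle k n) = - sign (row_cycle (Suc k) n)"
    using step.hyps by (simp add: row_cycle_step sign_compose permutation_swap_id sign_swap_id)
  also have "\<dots> = (- 1) ^ (n - k)"
    using step.IH step.hyps by (simp add: Suc_diff_Suc[symmetric])
  finally show ?case .
qed

section \<open>Finite sums and integer multiples in a commutative ring\<close>

context cring
begin

lemma finsum_UN_disjoint:
  assumes "finite I" "\<And>i. i \<in> I \<Longrightarrow> finite (S i)"
    and "pairwise (\<lambda>i j. disjnt (S i) (S j)) I"
    and "\<And>i x. i \<in> I \<Longrightarrow> x \<in> S i \<Longrightarrow> g x \<in> carrier R"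
  shows "finsum R g (\<Union>(S ` I)) = (\<Oplus>i\<in>I. finsum R g (S i))"
  using add.finprod_UN_disjoint[OF assms] by simp

lemma finsum_commute:
  assumes "finite I" "finite J" "\<And>i j. i \<in> I \<Longrightarrow> j \<in> J \<Longrightarrow> f i j \<in> carrier R"
  shows "(\<Oplus>i\<in>I. \<Oplus>j\<in>J. f i j) = (\<Oplus>j\<in>J. \<Oplus>i\<in>I. f i j)"
  using assms(1,3)
proof (induction I)
  case empty
  then show ?case by simp
next
  case (insert a I)
  have closed: "f a \<in> J \<rightarrow> carrier R" "(\<lambda>j. \<Oplus>i\<in>I. f i j) \<in> J \<rightarrow> carrier R"
    "(\<lambda>i. \<Oplus>j\<in>J. f i j) \<in> I \<rightarrow> carrier R"
    using insert.prems by (auto intro!: finsum_closed)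
  have "(\<Oplus>i\<in>insert a I. \<Oplus>j\<in>J. f i j) = (\<Oplus>j\<in>J. f a j) \<oplus> (\<Oplus>j\<in>J. \<Oplus>i\<in>I. f i j)"
    using insert closed by (simp add: finsum_closed)
  also have "\<dots> = (\<Oplus>j\<in>J. f a j \<oplus> (\<Oplus>i\<in>I. f i j))"
    using closed by (simp add: finsum_addf)
  also have "\<dots> = (\<Oplus>j\<in>J. \<Oplus>i\<in>insert a I. f i j)"
    using insert closed by (intro finsum_cong') (auto intro!: finsum_closed)
  finally show ?case .
qed

lemma add_pow_uminus_int: "x \<in> carrier R \<Longrightarrow> [(- k)] \<cdot> x = \<ominus> ([(k :: int)] \<cdot> x)"
  using add.int_pow_neg[of x k] by simp

lemma add_pow_mult_int: "x \<in> carrier R \<Longrightarrow> [(k :: int)] \<cdot> ([(l :: int)] \<cdot> x) = [(k * l)] \<cdot> x"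
  by (simp only: add.int_pow_pow mult.commute[of k l])

text \<open>Taking the \<open>k\<close>-fold multiple is multiplication by the ring element
  \<open>[k] \<cdot> \<one>\<close>, so this is distributivity.\<close>

lemma add_pow_finsum_int:
  assumes "finite S" "f \<in> S \<rightarrow> carrier R"
  shows "[(k :: int)] \<cdot> (\<Oplus>x\<in>S. f x) = (\<Oplus>x\<in>S. [k] \<cdot> f x)"
proof -
  have "[k] \<cdot> (\<Oplus>x\<in>S. f x) = [k] \<cdot> \<one> \<otimes> (\<Oplus>x\<in>S. f x)"
    using assms by (simp add: add_pow_ldistr_int finsum_closed)
  also have "\<dots> = (\<Oplus>x\<in>S. [k] \<cdot> \<one> \<otimes> f x)"
    using assms by (simp add: finsum_rdistr)
  also have "\<dots> = (\<Oplus>x\<in>S. [k] \<cdot> f x)"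
    using assms by (intro finsum_cong') (auto simp: add_pow_ldistr_int Pi_iff)
  finally show ?thesis .
qed

text \<open>Translates between the two kinds of sign in play: powers of the ring element
  \<open>\<ominus> \<one>\<close>, as in the formula for \<open>p0\<close>, and integer multiples,
  as in \<open>rdet\<close>.\<close>

lemma minus_one_pow_mult:
  assumes "x \<in> carrier R"
  shows "(\<ominus> \<one>) [^] k \<otimes> x = [((- 1 :: int) ^ k)] \<cdot> x"
proof (induction k)
  case 0
  then show ?case using assms by simp
next
  case (Suc k)
  have "(\<ominus> \<one>) [^] Suc k \<otimes> x = \<ominus> ((\<ominus> \<one>) [^] k \<otimes> x)"
    using assms by (simp add: l_minus r_minus)
  then show ?case
    using Suc assms by (simp add: add_pow_uminus_int)
qed

section \<open>Leibniz determinants: closure, congruence and repeated columns\<close>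

lemma rdet_term_closed:
  fixes \<sigma> :: "nat \<Rightarrow> nat"
  assumes "\<And>r s. r \<in> {1..m} \<Longrightarrow> s \<in> {1..m} \<Longrightarrow> M r s \<in> carrier R" "\<sigma> permutes {1..m}"
  shows "(\<Otimes>r\<in>{1..m}. M r (\<sigma> r)) \<in> carrier R"
proof (rule finprod_closed, rule)
  fix r assume "r \<in> {1..m}"
  then show "M r (\<sigma> r) \<in> carrier R"
    using assms permutes_in_image[OF assms(2)] by blast
qed

lemma rdet_closed:
  assumes "\<And>r s. r \<in> {1..m} \<Longrightarrow> s \<in> {1..m} \<Longrightarrow> M r s \<in> carrier R"
  shows "rdet R m M \<in> carrier R"
  unfolding rdet_def
  by (intro finsum_closed Pi_I add.int_pow_closed rdet_term_closed assms) simp_all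

lemma rdet_cong:
  assumes "\<And>r s. r \<in> {1..m} \<Longrightarrow> s \<in> {1..m} \<Longrightarrow> M r s = N r s"
    and "\<And>r s. r \<in> {1..m} \<Longrightarrow> s \<in> {1..m} \<Longrightarrow> N r s \<in> carrier R"
  shows "rdet R m M = rdet R m N"
proof -
  have "(\<Otimes>r\<in>{1..m}. M r (\<sigma> r)) = (\<Otimes>r\<in>{1..m}. N r (\<sigma> r))" if "\<sigma> permutes {1..m}" for \<sigma>
    using permutes_in_image[OF that] by (intro finprod_cong') (auto simp: assms)
  then show ?thesis
    unfolding rdet_def
    by (intro finsum_cong' refl Pi_I add.int_pow_closed rdet_term_closed assms(2)) simp_all
qed

text \<open>The terms of the Leibniz sum cancel in pairs \<open>\<sigma>\<close>, \<open>(j l) \<circ> \<sigma>\<close>, one of each parity.\<close>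

lemma rdet_eq_columns:
  assumes closed: "\<And>r s. r \<in> {1..m} \<Longrightarrow> s \<in> {1..m} \<Longrightarrow> M r s \<in> carrier R"
    and jl: "j \<in> {1..m}" "l \<in> {1..m}" "j \<noteq> l"
    and eq: "\<And>r. r \<in> {1..m} \<Longrightarrow> M r j = M r l"
  shows "rdet R m M = \<zero>"
proof -
  define t where "t = Transposition.transpose j l"
  define f where "f \<sigma> = [sign \<sigma>] \<cdot> (\<Otimes>r\<in>{1..m}. M r (\<sigma> r))" for \<sigma>
  define E where "E = {\<sigma>. \<sigma> permutes {1..m} \<and> evenperm \<sigma>}"
  define D where "D = {\<sigma>. \<sigma> permutes {1..m} \<and> \<not> evenperm \<sigma>}"
  have t: "t permutes {1..m}" "\<not> evenperm t" "permutation t" "t \<circ> t = id"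
    using jl unfolding t_def
    by (auto simp: permutes_swap_id evenperm_swap permutation_swap_id)
  have perm: "permutation \<sigma>" if "\<sigma> permutes {1..m}" for \<sigma>
    using that by (auto intro: permutes_imp_permutation)
  have parity: "evenperm (t \<circ> \<sigma>) \<longleftrightarrow> \<not> evenperm \<sigma>" if "\<sigma> permutes {1..m}" for \<sigma>
    using evenperm_comp[OF t(3) perm[OF that]] t(2) by blast
  have f_closed: "f \<sigma> \<in> carrier R" if "\<sigma> permutes {1..m}" for \<sigma>
    unfolding f_def by (intro add.int_pow_closed rdet_term_closed closed that)
  have fin: "finite {\<sigma>. \<sigma> permutes {1..m}}"
    by (rule finite_permutations) simp
  have finED: "finite E" "finite D"
    by (rule finite_subset[OF _ fin]; auto simp: E_def D_def)+
  \<comment> \<open>Composition with \<open>t\<close> is its own inverse, because \<open>t\<close>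
    is an involution.\<close>
  have inj: "inj_on ((\<circ>) t) E"
    by (rule inj_on_inverseI[where g = "(\<circ>) t"]) (simp add: t(4) flip: comp_assoc)
  have img: "(\<circ>) t ` E = D"
  proof (intro equalityI subsetI)
    fix \<sigma> assume "\<sigma> \<in> D"
    then have "t \<circ> \<sigma> \<in> E" "\<sigma> = t \<circ> (t \<circ> \<sigma>)"
      using t parity by (auto simp: E_def D_def permutes_compose simp flip: comp_assoc)
    then show "\<sigma> \<in> (\<circ>) t ` E" by blast
  qed (use t parity in \<open>auto simp: E_def D_def permutes_compose\<close>)
  have f_t: "f (t \<circ> \<sigma>) = \<ominus> f \<sigma>" if "\<sigma> permutes {1..m}" for \<sigma>
  proof -
    \<comment> \<open>Passing to \<open>t \<circ> \<sigma>\<close> only exchanges the columns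
      \<open>j\<close> and \<open>l\<close>, whose entries agree, so the product is unchanged and
      only the sign flips.\<close>
    have "(\<Otimes>r\<in>{1..m}. M r ((t \<circ> \<sigma>) r)) = (\<Otimes>r\<in>{1..m}. M r (\<sigma> r))"
      using permutes_in_image[OF that] eq
      by (intro finprod_cong') (auto simp: t_def Transposition.transpose_def closed)
    moreover have "sign (t \<circ> \<sigma>) = - sign \<sigma>"
      using parity[OF that] by (simp add: sign_def)
    ultimately show ?thesis
      using add_pow_uminus_int[OF rdet_term_closed[OF closed that]] unfolding f_def by simp
  qed
  have "rdet R m M = finsum R f (E \<union> D)"
    unfolding rdet_def f_def E_def D_def by (rule arg_cong[where f = "finsum R _"]) auto
  also have "\<dots> = finsum R f E \<oplus> finsum R f D"
    by (rule finsum_Un_disjoint[OF finED]) (auto simp: E_def D_def f_closed)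
  also have "finsum R f D = (\<Oplus>\<sigma>\<in>E. f (t \<circ> \<sigma>))"
    unfolding img[symmetric] by (rule finsum_reindex[OF _ inj]) (auto simp: img D_def f_closed)
  also have "\<dots> = (\<Oplus>\<sigma>\<in>E. \<ominus> f \<sigma>)"
    by (rule finsum_cong') (auto simp: E_def f_t f_closed)
  also have "finsum R f E \<oplus> \<dots> = (\<Oplus>\<sigma>\<in>E. f \<sigma> \<oplus> \<ominus> f \<sigma>)"
    by (rule finsum_addf[symmetric]) (auto simp: E_def f_closed)
  also have "\<dots> = (\<Oplus>\<sigma>\<in>E. \<zero>)"
    by (rule finsum_cong') (auto simp: E_def f_closed r_neg)
  finally show ?thesis by simp
qed

section \<open>Expansion along the last column and the relation between maximal minors\<close>

lemma drop_row_closed: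
  assumes "\<And>r s. r \<in> {1..Suc m} \<Longrightarrow> s \<in> {1..m} \<Longrightarrow> M r s \<in> carrier R"
    and "r \<in> {1..m}" "s \<in> {1..m}"
  shows "drop_row k M r s \<in> carrier R"
  using assms by (auto simp: drop_row_def)

text \<open>
  The permutations of \<open>{1..m + 1}\<close> sending \<open>k\<close> to \<open>m + 1\<close> are the \<open>\<sigma> \<circ> inv c\<close>, with \<open>c\<close> the cycle
  \<open>row_cycle k (m + 1)\<close> and \<open>\<sigma>\<close> a permutation of \<open>{1..m}\<close>.
\<close>

lemma rdet_last_column:
  assumes closed: "\<And>r s. r \<in> {1..Suc m} \<Longrightarrow> s \<in> {1..Suc m} \<Longrightarrow> M r s \<in> carrier R"
  shows "rdet R (Suc m) M =
    (\<Oplus>k\<in>{1..Suc m}. [((- 1 :: int) ^ (Suc m - k))] \<cdot> (M k (Suc m) \<otimes> rdet R m (drop_row k M)))"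
proof -
  define f where "f \<tau> = [sign \<tau>] \<cdot> (\<Otimes>r\<in>{1..Suc m}. M r (\<tau> r))" for \<tau>
  define S where "S k = {\<tau>. \<tau> permutes {1..Suc m} \<and> \<tau> k = Suc m}" for k
  have f_closed: "f \<tau> \<in> carrier R" if "\<tau> permutes {1..Suc m}" for \<tau>
    unfolding f_def by (intro add.int_pow_closed rdet_term_closed closed that)
  have fin: "finite (S k)" for k
    by (rule finite_subset[OF _ finite_permutations[of "{1..Suc m}"]]) (auto simp: S_def)
  \<comment> \<open>Every permutation takes the value \<open>Suc m\<close> at exactly one row
    \<open>k\<close>, so the Leibniz sum splits into the disjoint blocks \<open>S k\<close>.\<close>
  have "{\<tau>. \<tau> permutes {1..Suc m}} = \<Union>(S ` {1..Suc m})"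
  proof (intro equalityI subsetI)
    fix \<tau> assume "\<tau> \<in> {\<tau>. \<tau> permutes {1..Suc m}}"
    then have \<tau>: "\<tau> permutes {1..Suc m}" by simp
    then have "Suc m \<in> \<tau> ` {1..Suc m}" by (simp add: permutes_image)
    then show "\<tau> \<in> \<Union>(S ` {1..Suc m})" using \<tau> by (auto simp: S_def)
  qed (auto simp: S_def)
  then have "rdet R (Suc m) M = finsum R f (\<Union>(S ` {1..Suc m}))"
    by (simp only: rdet_def f_def[abs_def])
  also have "\<dots> = (\<Oplus>k\<in>{1..Suc m}. finsum R f (S k))"
  proof (rule finsum_UN_disjoint)
    show "pairwise (\<lambda>k l. disjnt (S k) (S l)) {1..Suc m}"
      by (auto simp: pairwise_def disjnt_def S_def)
        (metis permutes_inverses(2))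
  qed (use fin in \<open>auto simp: S_def f_closed\<close>)
  also have "\<dots> = (\<Oplus>k\<in>{1..Suc m}.
      [((- 1 :: int) ^ (Suc m - k))] \<cdot> (M k (Suc m) \<otimes> rdet R m (drop_row k M)))"
  proof (rule finsum_cong'[OF refl])
    show "(\<lambda>k. [((- 1 :: int) ^ (Suc m - k))] \<cdot> (M k (Suc m) \<otimes> rdet R m (drop_row k M)))
        \<in> {1..Suc m} \<rightarrow> carrier R"
      by (intro Pi_I add.int_pow_closed m_closed rdet_closed closed drop_row_closed[where m = m]) auto
  next
    fix k assume k: "k \<in> {1..Suc m}"
    define c where "c = row_cycle k (Suc m)"
    define P where "P = {\<sigma>. \<sigma> permutes {1..m}}"
    define g where "g \<sigma> = (\<Otimes>r\<in>{1..m}. drop_row k M r (\<sigma> r))" for \<sigma>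
    have c: "c permutes {1..Suc m}"
      unfolding c_def using k by (auto intro: permutes_subset[OF row_cycle_permutes])
    have c_last: "c (Suc m) = k"
      using k by (simp add: c_def row_cycle_def)
    have perm_c: "permutation c"
      using c by (auto intro: permutes_imp_permutation)
    have finP: "finite P"
      unfolding P_def by (rule finite_permutations) simp
    have P_Suc: "\<sigma> permutes {1..Suc m}" "\<sigma> (Suc m) = Suc m" if "\<sigma> \<in> P" for \<sigma>
      using that unfolding P_def
      by (auto intro: permutes_subset simp: permutes_not_in)
    have g_closed: "g \<sigma> \<in> carrier R" if "\<sigma> \<in> P" for \<sigma>
      using that unfolding g_def P_def
      by (intro rdet_term_closed drop_row_closed[where m = m] closed) auto
    have inj: "inj_on (\<lambda>\<sigma>. \<sigma> \<circ> inv_into UNIV c) P"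
      by (rule inj_on_inverseI[where g = "\<lambda>\<tau>. \<tau> \<circ> c"])
        (simp add: comp_assoc permutes_inv_o[OF c])
    have img: "S k = (\<lambda>\<sigma>. \<sigma> \<circ> inv_into UNIV c) ` P"
    proof (intro equalityI subsetI)
      fix \<tau> assume "\<tau> \<in> S k"
      then have \<tau>: "\<tau> permutes {1..Suc m}" "\<tau> k = Suc m" by (auto simp: S_def)
      \<comment> \<open>The cycle sends \<open>Suc m\<close> to \<open>k\<close> and
        \<open>\<tau>\<close> sends \<open>k\<close> back to \<open>Suc m\<close>; the composite
        fixes \<open>Suc m\<close> and hence restricts to a permutation of
        \<open>{1..m}\<close>.\<close>
      have "\<tau> \<circ> c permutes {1..m}"
      proof (rule permutes_superset)
        show "\<tau> \<circ> c permutes {1..Suc m}" by (rule permutes_compose[OF c \<tau>(1)])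
        fix r assume "r \<in> {1..Suc m} - {1..m}"
        then have "r = Suc m" by auto
        then show "(\<tau> \<circ> c) r = r" by (simp add: c_last \<tau>)
      qed
      then have "\<tau> \<circ> c \<in> P" by (simp add: P_def)
      moreover have "\<tau> = \<tau> \<circ> c \<circ> inv_into UNIV c"
        by (simp add: comp_assoc permutes_inv_o[OF c])
      ultimately show "\<tau> \<in> (\<lambda>\<sigma>. \<sigma> \<circ> inv_into UNIV c) ` P" by blast
    next
      fix \<tau> assume "\<tau> \<in> (\<lambda>\<sigma>. \<sigma> \<circ> inv_into UNIV c) ` P"
      then obtain \<sigma> where \<sigma>: "\<sigma> \<in> P" "\<tau> = \<sigma> \<circ> inv_into UNIV c" by blast
      have "inv_into UNIV c k = Suc m"
        using c c_last by (simp add: permutes_inv_eq)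
      then show "\<tau> \<in> S k"
        using \<sigma> P_Suc c by (auto simp: S_def intro!: permutes_compose permutes_inv)
    qed
    have Mk: "M k (Suc m) \<in> carrier R" using k by (intro closed) auto
    have f_comp: "f (\<sigma> \<circ> inv_into UNIV c) =
        [((- 1 :: int) ^ (Suc m - k))] \<cdot> (M k (Suc m) \<otimes> [sign \<sigma>] \<cdot> g \<sigma>)" if \<sigma>: "\<sigma> \<in> P" for \<sigma>
    proof -
      let ?\<tau> = "\<sigma> \<circ> inv_into UNIV c"
      have \<tau>: "?\<tau> permutes {1..Suc m}"
        using P_Suc(1)[OF \<sigma>] c by (intro permutes_compose permutes_inv)
      have M_closed: "M r (?\<tau> r) \<in> carrier R" if "r \<in> {1..Suc m}" for r
        using that permutes_in_image[OF \<tau>] by (intro closed) blast+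
      have c_in: "c r \<in> {1..Suc m}" if "r \<in> {1..Suc m}" for r
        using that permutes_in_image[OF c] by blast
      have \<tau>c: "?\<tau> (c r) = \<sigma> r" for r
        by (simp add: permutes_inverses(2)[OF c])
      have \<sigma>_closed: "M (c r) (\<sigma> r) \<in> carrier R" if "r \<in> {1..Suc m}" for r
        using M_closed[OF c_in[OF that]] \<tau>c by simp
      have rows: "{1..Suc m} = insert (Suc m) {1..m}" by auto
      \<comment> \<open>Listing the rows in the order given by \<open>c\<close> puts row
        \<open>k\<close>, with its entry in the last column, at index \<open>Suc m\<close>. The
        indices \<open>1..m\<close> then run through the rows of
        \<open>drop_row k M\<close>.\<close>
      have "(\<Otimes>r\<in>{1..Suc m}. M r (?\<tau> r)) = (\<Otimes>r\<in>c ` {1..Suc m}. M r (?\<tau> r))"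
        by (simp only: permutes_image[OF c])
      also have "\<dots> = (\<Otimes>r\<in>{1..Suc m}. M (c r) (?\<tau> (c r)))"
        using M_closed c_in by (intro finprod_reindex permutes_inj_on[OF c]) auto
      also have "\<dots> = (\<Otimes>r\<in>insert (Suc m) {1..m}. M (c r) (\<sigma> r))"
        by (simp only: \<tau>c rows)
      also have "\<dots> = M (c (Suc m)) (\<sigma> (Suc m)) \<otimes> (\<Otimes>r\<in>{1..m}. M (c r) (\<sigma> r))"
        using \<sigma>_closed by (intro finprod_insert) auto
      also have "(\<Otimes>r\<in>{1..m}. M (c r) (\<sigma> r)) = g \<sigma>"
      proof -
        have "drop_row k M r (\<sigma> r) = M (c r) (\<sigma> r)" if "r \<in> {1..m}" for r
          using that by (auto simp: c_def row_cycle_def drop_row_def)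
        then show ?thesis
          unfolding g_def using \<sigma>_closed by (intro finprod_cong'[symmetric]) auto
      qed
      finally have prod: "(\<Otimes>r\<in>{1..Suc m}. M r (?\<tau> r)) = M k (Suc m) \<otimes> g \<sigma>"
        using P_Suc(2)[OF \<sigma>] c_last by simp
      have "permutation \<sigma>"
        using \<sigma> unfolding P_def by (auto intro: permutes_imp_permutation)
      \<comment> \<open>A permutation and its inverse have the same sign, so the factor is the sign
        of the cycle \<open>c\<close>.\<close>
      then have "sign ?\<tau> = (- 1) ^ (Suc m - k) * sign \<sigma>"
        using sign_compose[OF _ permutation_inverse[OF perm_c]] sign_inverse[OF perm_c]
          sign_row_cycle[of k "Suc m"] k
        by (simp add: c_def)
      then show ?thesis
        unfolding f_def prod
        by (simp only: add_pow_rdistr_int[OF Mk g_closed[OF \<sigma>]]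
            add_pow_mult_int[OF m_closed[OF Mk g_closed[OF \<sigma>]]])
    qed
    have sg_closed: "[sign \<sigma>] \<cdot> g \<sigma> \<in> carrier R" if "\<sigma> \<in> P" for \<sigma>
      by (intro add.int_pow_closed g_closed that)
    have "finsum R f (S k) = (\<Oplus>\<sigma>\<in>P. f (\<sigma> \<circ> inv_into UNIV c))"
      unfolding img by (rule finsum_reindex[OF _ inj]) (auto simp: img[symmetric] S_def f_closed)
    also have "\<dots> = (\<Oplus>\<sigma>\<in>P. [((- 1 :: int) ^ (Suc m - k))] \<cdot> (M k (Suc m) \<otimes> [sign \<sigma>] \<cdot> g \<sigma>))"
      by (rule finsum_cong'[OF refl _ f_comp])
        (auto intro!: add.int_pow_closed m_closed Mk g_closed)
    also have "\<dots> = [((- 1 :: int) ^ (Suc m - k))] \<cdot> (\<Oplus>\<sigma>\<in>P. M k (Suc m) \<otimes> [sign \<sigma>] \<cdot> g \<sigma>)"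
      by (rule add_pow_finsum_int[symmetric, OF finP]) (auto intro!: m_closed Mk sg_closed)
    also have "(\<Oplus>\<sigma>\<in>P. M k (Suc m) \<otimes> [sign \<sigma>] \<cdot> g \<sigma>) = M k (Suc m) \<otimes> (\<Oplus>\<sigma>\<in>P. [sign \<sigma>] \<cdot> g \<sigma>)"
      by (rule finsum_rdistr[symmetric, OF finP Mk]) (auto intro!: sg_closed)
    also have "(\<Oplus>\<sigma>\<in>P. [sign \<sigma>] \<cdot> g \<sigma>) = rdet R m (drop_row k M)"
      by (simp add: rdet_def P_def g_def)
    finally show "finsum R f (S k) =
        [((- 1 :: int) ^ (Suc m - k))] \<cdot> (M k (Suc m) \<otimes> rdet R m (drop_row k M))" .
  qed
  finally show ?thesis .
qed

lemma maximal_minors_syzygy: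
  assumes closed: "\<And>r s. r \<in> {1..Suc m} \<Longrightarrow> s \<in> {1..m} \<Longrightarrow> A r s \<in> carrier R"
    and j: "j \<in> {1..m}"
  shows "(\<Oplus>k\<in>{1..Suc m}. (\<ominus> \<one>) [^] k \<otimes> rdet R m (drop_row k A) \<otimes> A k j) = \<zero>"
proof -
  \<comment> \<open>The square matrix obtained by appending a second copy of column \<open>j\<close>
    as column \<open>Suc m\<close>.\<close>
  define B where "B r s = (if s = Suc m then A r j else A r s)" for r s
  have B_closed: "B r s \<in> carrier R" if "r \<in> {1..Suc m}" "s \<in> {1..Suc m}" for r s
    using that j by (auto simp: B_def closed)
  have "rdet R (Suc m) B = \<zero>"
    by (rule rdet_eq_columns[of _ _ j "Suc m"]) (use j B_closed in \<open>auto simp: B_def\<close>)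
  \<comment> \<open>The extra factor \<open>(- 1) ^ Suc m\<close> turns the expansion signs
    \<open>(- 1) ^ (Suc m - k)\<close> into the signs \<open>(- 1) ^ k\<close> of the claim.\<close>
  then have zero: "\<zero> = [((- 1 :: int) ^ Suc m)] \<cdot>
      (\<Oplus>k\<in>{1..Suc m}. [((- 1 :: int) ^ (Suc m - k))] \<cdot> (B k (Suc m) \<otimes> rdet R m (drop_row k B)))"
    using rdet_last_column[of m B] B_closed add.int_pow_one by simp
  \<comment> \<open>A determinant of size \<open>m\<close> only reads the columns
    \<open>1..m\<close>, where \<open>A\<close> and \<open>B\<close> agree.\<close>
  have minor: "rdet R m (drop_row k B) = rdet R m (drop_row k A)" for k
    by (rule rdet_cong) (auto simp: drop_row_def B_def closed)
  have Bt: "B k (Suc m) = A k j" for k by (simp add: B_def)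
  have minor_closed: "rdet R m (drop_row k A) \<in> carrier R" for k
    by (intro rdet_closed drop_row_closed closed)
  have term_closed: "A k j \<otimes> rdet R m (drop_row k A) \<in> carrier R" if "k \<in> {1..Suc m}" for k
    using that j by (intro m_closed minor_closed closed)
  note zero
  also have "[((- 1 :: int) ^ Suc m)] \<cdot>
      (\<Oplus>k\<in>{1..Suc m}. [((- 1 :: int) ^ (Suc m - k))] \<cdot> (B k (Suc m) \<otimes> rdet R m (drop_row k B)))
    = (\<Oplus>k\<in>{1..Suc m}. [((- 1 :: int) ^ Suc m)] \<cdot>
        ([((- 1 :: int) ^ (Suc m - k))] \<cdot> (A k j \<otimes> rdet R m (drop_row k A))))"
    unfolding minor Bt
    by (rule add_pow_finsum_int) (auto intro!: add.int_pow_closed term_closed)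
  also have "\<dots> = (\<Oplus>k\<in>{1..Suc m}. (\<ominus> \<one>) [^] k \<otimes> rdet R m (drop_row k A) \<otimes> A k j)"
  proof (rule finsum_cong'[OF refl])
    show "(\<lambda>k. (\<ominus> \<one>) [^] k \<otimes> rdet R m (drop_row k A) \<otimes> A k j) \<in> {1..Suc m} \<rightarrow> carrier R"
      using j by (auto intro!: m_closed minor_closed closed)
    fix k assume k: "k \<in> {1..Suc m}"
    \<comment> \<open>The three exponents have an even sum, and \<open>(- 1) ^ k\<close> is its own
      inverse, so the first two signs multiply to \<open>(- 1) ^ k\<close>.\<close>
    have "Suc m + (Suc m - k) + k = 2 * Suc m" using k by simp
    then have "(- 1 :: int) ^ Suc m * (- 1) ^ (Suc m - k) * (- 1) ^ k = 1"
      by (simp only: power_add[symmetric] power_mult) simp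
    then have "(- 1 :: int) ^ Suc m * (- 1) ^ (Suc m - k) = (- 1) ^ k"
      by (metis left_minus_one_mult_self mult.commute mult.right_neutral)
    then have "[((- 1 :: int) ^ Suc m)] \<cdot>
        ([((- 1 :: int) ^ (Suc m - k))] \<cdot> (A k j \<otimes> rdet R m (drop_row k A)))
      = (\<ominus> \<one>) [^] k \<otimes> (A k j \<otimes> rdet R m (drop_row k A))"
      by (simp only: add_pow_mult_int[OF term_closed[OF k]] minus_one_pow_mult[OF term_closed[OF k]])
    then show "[((- 1 :: int) ^ Suc m)] \<cdot>
        ([((- 1 :: int) ^ (Suc m - k))] \<cdot> (A k j \<otimes> rdet R m (drop_row k A)))
      = (\<ominus> \<one>) [^] k \<otimes> rdet R m (drop_row k A) \<otimes> A k j"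
      using minor_closed[of k] closed[OF k j] by (simp add: m_ac)
  qed
  finally show ?thesis by simp
qed

end

subsection \<open>Radicals\<close>

context cring
begin

lemma radical_mono: "I \<subseteq> J \<Longrightarrow> radical R I \<subseteq> radical R J"
  by (auto simp: radical_def)

lemma subset_radical: "ideal I R \<Longrightarrow> I \<subseteq> radical R I"
proof
  fix x assume I: "ideal I R" and x: "x \<in> I"
  then have "x \<in> carrier R" by (rule ideal.Icarr)
  then have "x [^] (1::nat) \<in> I" using x by simp
  then show "x \<in> radical R I" using \<open>x \<in> carrier R\<close> unfolding radical_def by blast
qed

text \<open>The factor \<open>z\<close> makes the induction work without the binomial theorem.\<close>

lemma add_pow_mem_ideal:
  assumes I: "ideal I R" and xy: "x \<in> carrier R" "y \<in> carrier R"
  shows "z \<in> carrier R \<Longrightarrow> z \<otimes> x [^] (a::nat) \<in> I \<Longrightarrow> z \<otimes> y [^] (b::nat) \<in> I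
    \<Longrightarrow> z \<otimes> (x \<oplus> y) [^] (a + b) \<in> I"
proof (induction "a + b" arbitrary: z a b)
  case 0
  then show ?case by simp
next
  case (Suc s)
  show ?case
  proof (cases "a = 0 \<or> b = 0")
    case True
    \<comment> \<open>A zero exponent makes the corresponding hypothesis say that \<open>z\<close>
      itself lies in \<open>I\<close>.\<close>
    then have "z \<in> I" using Suc.prems by auto
    then show ?thesis using xy by (intro ideal.I_r_closed[OF I]) auto
  next
    case False
    then obtain a' b' where ab: "a = Suc a'" "b = Suc b'" "s = a' + b" "s = a + b'"
      using Suc.hyps(2) by (metis add_Suc add_Suc_right nat.inject old.nat.exhaust)
    \<comment> \<open>One factor \<open>x \<oplus> y\<close> is multiplied out, which replaces
      \<open>z\<close> by \<open>z \<otimes> x\<close> and by \<open>z \<otimes> y\<close>.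
      Absorbing \<open>x\<close> lowers \<open>a\<close> by one and keeps the hypothesis on
      \<open>y\<close>; absorbing \<open>y\<close> does the reverse. The induction hypothesis thus
      applies to \<open>(a', b)\<close> and to \<open>(a, b')\<close>.\<close>
    have "z \<otimes> x \<otimes> y [^] b \<in> I" "z \<otimes> y \<otimes> x [^] a \<in> I"
      using ideal.I_r_closed[OF I Suc.prems(3) xy(1)] ideal.I_r_closed[OF I Suc.prems(2) xy(2)]
        Suc.prems(1) xy by (simp_all add: m_ac)
    moreover have "z \<otimes> x \<otimes> x [^] a' \<in> I" "z \<otimes> y \<otimes> y [^] b' \<in> I"
      using Suc.prems xy ab by (simp_all add: m_ac)
    ultimately have "z \<otimes> x \<otimes> (x \<oplus> y) [^] s \<in> I" "z \<otimes> y \<otimes> (x \<oplus> y) [^] s \<in> I"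
      using Suc.hyps(1)[of a' b "z \<otimes> x"] Suc.hyps(1)[of a b' "z \<otimes> y"] Suc.prems(1) xy ab
      by auto
    then have "z \<otimes> x \<otimes> (x \<oplus> y) [^] s \<oplus> z \<otimes> y \<otimes> (x \<oplus> y) [^] s \<in> I"
      by (rule additive_subgroup.a_closed[OF ideal.axioms(1)[OF I]])
    also have "z \<otimes> x \<otimes> (x \<oplus> y) [^] s \<oplus> z \<otimes> y \<otimes> (x \<oplus> y) [^] s = z \<otimes> (x \<oplus> y) [^] Suc s"
      using Suc.prems(1) xy by (simp add: l_distr r_distr m_ac)
    finally show ?thesis using Suc.hyps(2) by simp
  qed
qed

text \<open>Sums are handled by \<open>add_pow_mem_ideal\<close> with \<open>z = \<one>\<close>, and
  negatives by closure under multiplication by \<open>\<ominus> \<one>\<close>.\<close>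

lemma radical_ideal:
  assumes I: "ideal I R"
  shows "ideal (radical R I) R"
proof -
  have mult: "r \<otimes> x \<in> radical R I" if "x \<in> radical R I" "r \<in> carrier R" for r x
    using that by (auto simp: radical_def nat_pow_distrib intro: ideal.I_l_closed[OF I])
  show ?thesis
  proof (rule idealI[OF ring_axioms])
    show "subgroup (radical R I) (add_monoid R)"
    proof (rule add.subgroupI)
      show "radical R I \<subseteq> carrier R" by (auto simp: radical_def)
      show "radical R I \<noteq> {}"
        using subset_radical[OF I] additive_subgroup.zero_closed[OF ideal.axioms(1)[OF I]] by blast
    next
      fix x assume x: "x \<in> radical R I"
      then have "\<ominus> x = (\<ominus> \<one>) \<otimes> x" by (auto simp: radical_def l_minus)
      then show "\<ominus> x \<in> radical R I" using mult[OF x] by simp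
    next
      fix x y assume "x \<in> radical R I" "y \<in> radical R I"
      then obtain a b :: nat where ab: "x \<in> carrier R" "y \<in> carrier R" "a > 0"
        "x [^] a \<in> I" "y [^] b \<in> I"
        by (auto simp: radical_def)
      then have "\<one> \<otimes> (x \<oplus> y) [^] (a + b) \<in> I"
        by (intro add_pow_mem_ideal[OF I]) auto
      then show "x \<oplus> y \<in> radical R I"
        using ab by (auto simp: radical_def intro!: exI[of _ "a + b"])
    qed
  next
    fix x r assume xr: "x \<in> radical R I" "r \<in> carrier R"
    then show "r \<otimes> x \<in> radical R I" by (rule mult)
    moreover have "x \<in> carrier R" using xr by (simp add: radical_def)
    ultimately show "x \<otimes> r \<in> radical R I" using xr by (simp add: m_comm)
  qed
qed

text \<open>If a power of \<open>x\<close> lies in \<open>I\<close>, some power of that power lies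
  in \<open>J\<close>. Since \<open>radical R J\<close> is an ideal whenever \<open>J\<close> is,
  this reduces an inclusion of radicals to a check on generators of \<open>I\<close>.\<close>

lemma radical_subset_radical:
  assumes "I \<subseteq> radical R J"
  shows "radical R I \<subseteq> radical R J"
proof
  fix x assume "x \<in> radical R I"
  then obtain a :: nat where x: "x \<in> carrier R" "a > 0" "x [^] a \<in> radical R J"
    using assms by (auto simp: radical_def)
  then obtain b :: nat where "b > 0" "x [^] (a * b) \<in> J"
    by (auto simp: radical_def nat_pow_pow)
  then show "x \<in> radical R J"
    using x unfolding radical_def by (auto intro!: exI[of _ "a * b"])
qed

lemma finsum_mem_ideal:
  assumes I: "ideal I R"
  shows "f \<in> S \<rightarrow> I \<Longrightarrow> finsum R f S \<in> I"
proof (induction S rule: infinite_finite_induct)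
  case (insert x S)
  have "I \<subseteq> carrier R" using ideal.Icarr[OF I] by blast
  then have "finsum R f (insert x S) = f x \<oplus> finsum R f S"
    using insert by (intro finsum_insert) auto
  then show ?case
    using insert additive_subgroup.a_closed[OF ideal.axioms(1)[OF I]] by auto
\<comment> \<open>Over an infinite index set \<open>finsum\<close> is zero by convention, so that
  case is settled like the empty one.\<close>
qed (use additive_subgroup.zero_closed[OF ideal.axioms(1)[OF I]] in simp_all)

end

section \<open>Comparison of the two radicals\<close>

theorem theorem1:
  fixes R :: "('a, 'b) ring_scheme" (structure)
    and n :: nat
    and A :: "nat \<Rightarrow> nat \<Rightarrow> 'a"
    and p c \<alpha> \<Delta> q :: "nat \<Rightarrow> 'a"
    and p0 :: 'a
    and i :: "nat \<Rightarrow> nat"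
  assumes "cring R"
    and "noetherian_ring R"
    and "n \<ge> 2"
    and "\<And>j. j \<in> {1..n-1} \<Longrightarrow> p j \<in> carrier R"
    and "\<And>k. k \<in> {1..n} \<Longrightarrow> c k \<in> carrier R"
    and "\<And>k. k \<in> {1..n} \<Longrightarrow> i k \<in> {1..n-1}"
    and "\<And>k. k \<in> {1..n} \<Longrightarrow> \<alpha> k \<in> carrier R"
    and "\<And>k j. k \<in> {1..n} \<Longrightarrow> j \<in> {1..n-1} \<Longrightarrow> A k j = c k \<otimes> basis_row R (i k) j"
    and "\<And>k. k \<in> {1..n} \<Longrightarrow> \<Delta> k = rdet R (n-1) (drop_row k A)"
    and "p0 = (\<Oplus>k\<in>{1..n}. (\<ominus> \<one>) [^] k \<otimes> \<alpha> k \<otimes> \<Delta> k)"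
    and "\<And>k. k \<in> {1..n} \<Longrightarrow> q k = \<alpha> k \<otimes> p0 \<oplus> c k \<otimes> p (i k)"
  shows "radical R (Idl ({p0} \<union> (\<lambda>k. c k \<otimes> p (i k)) ` {1..n})) = radical R (Idl (q ` {1..n}))"
proof -
  interpret cring R by fact
  note [simp] = assms(4,5,7)
  define m where "m = n - 1"
  have n: "n = Suc m" using assms(3) by (simp add: m_def)
  have ik: "i k \<in> {1..m}" if "k \<in> {1..n}" for k
    using assms(6)[OF that] by (simp add: m_def)
  have pj: "p j \<in> carrier R" if "j \<in> {1..m}" for j
    using assms(4) that by (simp add: m_def)
  have A: "A k j = c k \<otimes> (if j = i k then \<one> else \<zero>)" if "k \<in> {1..n}" "j \<in> {1..m}" for k j
    using assms(8) that by (simp add: m_def basis_row_def)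
  have A_closed: "A k j \<in> carrier R" if "k \<in> {1..n}" "j \<in> {1..m}" for k j
    using A[OF that] that by simp
  have \<Delta>: "\<Delta> k = rdet R m (drop_row k A)" if "k \<in> {1..n}" for k
    using assms(9)[OF that] by (simp add: m_def)
  have \<Delta>_closed: "\<Delta> k \<in> carrier R" if "k \<in> {1..n}" for k
    unfolding \<Delta>[OF that] using A_closed by (intro rdet_closed drop_row_closed[where m = m]) (auto simp: n)
  \<comment> \<open>The signed minors are the coefficients both of \<open>p0\<close> in terms of the
    \<open>\<alpha> k\<close> and of the linear relation between the rows of
    \<open>A\<close>.\<close>
  define d where "d k = (\<ominus> \<one>) [^] k \<otimes> \<Delta> k" for k
  have d: "d k \<in> carrier R" if "k \<in> {1..n}" for k
    using \<Delta>_closed[OF that] by (simp add: d_def)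
  define e where "e k = c k \<otimes> p (i k)" for k
  have e: "e k \<in> carrier R" if "k \<in> {1..n}" for k
    unfolding e_def by (intro m_closed assms(5) pj ik that)
  \<comment> \<open>Row \<open>k\<close> of \<open>A\<close> vanishes outside column
    \<open>i k\<close>, so its product with the column of the \<open>p j\<close> has only one
    surviving term.\<close>
  have e_row: "e k = (\<Oplus>j\<in>{1..m}. A k j \<otimes> p j)" if k: "k \<in> {1..n}" for k
  proof -
    have "(\<Oplus>j\<in>{1..m}. A k j \<otimes> p j) = (\<Oplus>j\<in>{1..m}. if i k = j then c k \<otimes> p j else \<zero>)"
      using k pj by (intro finsum_cong') (auto simp: A)
    also have "\<dots> = c k \<otimes> p (i k)"
      using k pj ik by (intro finsum_singleton) auto
    finally show ?thesis by (simp add: e_def)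
  qed
  have p0: "p0 = (\<Oplus>k\<in>{1..n}. d k \<otimes> \<alpha> k)"
    unfolding assms(10) d_def using \<Delta>_closed by (intro finsum_cong') (auto simp: m_ac)
  have p0_closed: "p0 \<in> carrier R"
    unfolding p0 using d by (intro finsum_closed) auto
  have q: "q k = \<alpha> k \<otimes> p0 \<oplus> e k" if "k \<in> {1..n}" for k
    using assms(11)[OF that] by (simp add: e_def)
  have q_closed: "q k \<in> carrier R" if "k \<in> {1..n}" for k
    using q[OF that] e[OF that] p0_closed that by simp
  \<comment> \<open>With \<open>e k\<close> expanded along row \<open>k\<close> and the two sums
    exchanged, the inner sum for each column \<open>j\<close> is the relation of
    \<open>maximal_minors_syzygy\<close> times \<open>p j\<close>.\<close>
  have "(\<Oplus>k\<in>{1..n}. d k \<otimes> e k) = (\<Oplus>k\<in>{1..n}. \<Oplus>j\<in>{1..m}. d k \<otimes> A k j \<otimes> p j)"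
    using d A_closed pj
    by (intro finsum_cong') (auto simp: e_row finsum_rdistr m_assoc intro!: finsum_closed finsum_cong')
  also have "\<dots> = (\<Oplus>j\<in>{1..m}. \<Oplus>k\<in>{1..n}. d k \<otimes> A k j \<otimes> p j)"
    using d A_closed pj by (intro finsum_commute) auto
  also have "\<dots> = (\<Oplus>j\<in>{1..m}. \<zero>)"
  proof (rule finsum_cong'[OF refl])
    fix j assume j: "j \<in> {1..m}"
    have "(\<Oplus>k\<in>{1..n}. d k \<otimes> A k j \<otimes> p j) = (\<Oplus>k\<in>{1..n}. d k \<otimes> A k j) \<otimes> p j"
      using j d A_closed pj by (intro finsum_ldistr[symmetric]) auto
    also have "(\<Oplus>k\<in>{1..n}. d k \<otimes> A k j)
        = (\<Oplus>k\<in>{1..Suc m}. (\<ominus> \<one>) [^] k \<otimes> rdet R m (drop_row k A) \<otimes> A k j)"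
      using j A_closed \<Delta>_closed
      by (intro finsum_cong') (auto simp: n d_def \<Delta>[unfolded n])
    also have "\<dots> = \<zero>"
      using A_closed by (intro maximal_minors_syzygy j) (auto simp: n)
    finally show "(\<Oplus>k\<in>{1..n}. d k \<otimes> A k j \<otimes> p j) = \<zero>" using j pj by simp
  qed auto
  finally have syzygy: "(\<Oplus>k\<in>{1..n}. d k \<otimes> e k) = \<zero>" by simp
  have "(\<Oplus>k\<in>{1..n}. d k \<otimes> q k) = (\<Oplus>k\<in>{1..n}. d k \<otimes> \<alpha> k \<otimes> p0 \<oplus> d k \<otimes> e k)"
    using d e p0_closed by (intro finsum_cong') (auto simp: q r_distr m_assoc)
  also have "\<dots> = (\<Oplus>k\<in>{1..n}. d k \<otimes> \<alpha> k \<otimes> p0) \<oplus> (\<Oplus>k\<in>{1..n}. d k \<otimes> e k)"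
    using d e p0_closed by (intro finsum_addf) auto
  \<comment> \<open>Pulling out the common factor \<open>p0\<close> leaves the sum that defines
    \<open>p0\<close>.\<close>
  also have "(\<Oplus>k\<in>{1..n}. d k \<otimes> \<alpha> k \<otimes> p0) = p0 \<otimes> p0"
    using d p0_closed finsum_ldistr[of "{1..n}" p0 "\<lambda>k. d k \<otimes> \<alpha> k"] p0 by auto
  finally have p0_sq: "p0 [^] (2::nat) = (\<Oplus>k\<in>{1..n}. d k \<otimes> q k)"
    using syzygy p0_closed by (simp add: numeral_2_eq_2)

  define G where "G = {p0} \<union> e ` {1..n}"
  define J where "J = Idl (q ` {1..n})"
  have G_sub: "G \<subseteq> carrier R" using p0_closed e by (auto simp: G_def)
  have q_sub: "q ` {1..n} \<subseteq> carrier R" using q_closed by auto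
  have J: "ideal J R" unfolding J_def by (rule genideal_ideal[OF q_sub])
  have qJ: "q k \<in> J" if "k \<in> {1..n}" for k
    using genideal_self[OF q_sub] that by (auto simp: J_def)
  have radJ: "ideal (radical R J) R" by (rule radical_ideal[OF J])
  interpret radJ: ideal "radical R J" R by (rule radJ)
  have "(\<Oplus>k\<in>{1..n}. d k \<otimes> q k) \<in> J"
    by (rule finsum_mem_ideal[OF J]) (auto intro!: ideal.I_l_closed[OF J] qJ d)
  then have "p0 [^] (2::nat) \<in> J" by (simp add: p0_sq)
  then have p0_rad: "p0 \<in> radical R J"
    using p0_closed zero_less_numeral unfolding radical_def by blast
  have e_rad: "e k \<in> radical R J" if k: "k \<in> {1..n}" for k
  proof -
    have x: "\<alpha> k \<otimes> p0 \<in> carrier R" using k p0_closed by simp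
    \<comment> \<open>The right-hand side is arranged so that \<open>r_neg1\<close> cancels
      \<open>\<alpha> k \<otimes> p0\<close> and leaves \<open>e k\<close>.\<close>
    have "q k \<oplus> (\<ominus> \<alpha> k) \<otimes> p0 = \<ominus> (\<alpha> k \<otimes> p0) \<oplus> (\<alpha> k \<otimes> p0 \<oplus> e k)"
      unfolding q[OF k] using k e[OF k] p0_closed
      by (simp add: l_minus a_comm[OF _ a_inv_closed[OF x]])
    then have "e k = q k \<oplus> (\<ominus> \<alpha> k) \<otimes> p0"
      using r_neg1[OF x e[OF k]] by simp
    moreover have "q k \<in> radical R J" using qJ[OF k] subset_radical[OF J] by blast
    ultimately show ?thesis
      using k by (simp add: radJ.a_closed radJ.I_l_closed p0_rad)
  qed
  \<comment> \<open>The ideal \<open>radical R J\<close> contains all generators in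
    \<open>G\<close>, hence \<open>Idl G\<close>. Conversely each \<open>q k\<close> is a
    combination of \<open>p0\<close> and \<open>e k\<close>, which gives
    \<open>J \<subseteq> Idl G\<close>.\<close>
  have "radical R (Idl G) \<subseteq> radical R J"
    by (intro radical_subset_radical genideal_minimal radJ) (auto simp: G_def p0_rad e_rad)
  moreover have "J \<subseteq> Idl G"
    unfolding J_def
  proof (rule genideal_minimal[OF genideal_ideal[OF G_sub]])
    interpret G: ideal "Idl G" R by (rule genideal_ideal[OF G_sub])
    have "p0 \<in> Idl G" "e k \<in> Idl G" if "k \<in> {1..n}" for k
      using genideal_self[OF G_sub] that by (auto simp: G_def)
    then show "q ` {1..n} \<subseteq> Idl G"
      by (auto simp: q intro!: G.a_closed G.I_l_closed)
  qed
  ultimately have "radical R (Idl G) = radical R J"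
    using radical_mono[of J "Idl G"] by blast
  then show ?thesis by (simp only: G_def J_def e_def[abs_def])
qed

end
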